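(* Let $d\ge 1$ and let $\{U_1,\ldots,U_{d+1}\}$ be a sunflower of convex open sets in $\mathbb R^d$ with center $U$. Then every (affine) hyperplane $H\subseteq\mathbb R^d$ which intersects all of $U_1,\ldots,U_{d+1}$ also intersects $U$.
   Context: A sunflower is a collection of sets $\{U_1,\ldots,U_n\}$ such that $U_i\cap U_j=\bigcap_{k=1}^n U_k\neq\emptyset$ for all distinct $i,j$. The sets $U_i$ are the petals and $\bigcap_{k=1}^n U_k$ is the center of the sunflower. *)

theory Defs
  imports "HOL-Analysis.Analysis"
begin

definition center :: "nat \<Rightarrow> (nat \<Rightarrow> 'a set) \<Rightarrow> 'a set"
  where "center n U = (\<Inter>k\<in>{1..n}. U k)"

text \<open>The petals are an indexed family \<open>U 1, \<dots>, U n\<close>; as in the informal definition, distinctness is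
  required of the indices only.\<close>

definition sunflower :: "nat \<Rightarrow> (nat \<Rightarrow> 'a set) \<Rightarrow> bool"
  where "sunflower n U \<longleftrightarrow>
    (\<forall>i\<in>{1..n}. \<forall>j\<in>{1..n}. i \<noteq> j \<longrightarrow> U i \<inter> U j = center n U \<and> center n U \<noteq> {})"

definition hyperplane :: "'a::euclidean_space set \<Rightarrow> bool"
  where "hyperplane H \<longleftrightarrow> (\<exists>a b. a \<noteq> 0 \<and> H = {x. a \<bullet> x = b})"

lemma hyperplane_iff_aff_dim:
  "hyperplane (H :: 'a::euclidean_space set) \<longleftrightarrow> affine H \<and> aff_dim H = int DIM('a) - 1"
proof
  assume "hyperplane H"
  then show "affine H \<and> aff_dim H = int DIM('a) - 1"
    by (auto simp: hyperplane_def affine_hyperplane aff_dim_hyperplane)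
next
  assume H: "affine H \<and> aff_dim H = int DIM('a) - 1"
  then have "affine hull H = H"
    by (simp add: affine_hull_eq)
  with H aff_dim_eq_hyperplane[of H] show "hyperplane H"
    by (simp add: hyperplane_def)
qed

end

theory Submission
  imports Defs
begin

text \<open>Taking the convex hull of some of the petals preserves the property of meeting each remaining
  petal exactly in the center: at a boundary point of the center inside a petal, a supporting
  hyperplane of the center must bound every other petal. Now pick a point of each petal on the
  hyperplane. These \<open>d + 1\<close> points of a \<open>(d - 1)\<close>-dimensional flat have a Radon partition, and
  their Radon point lies in the hulls of two disjoint groups of petals, hence in the center.\<close>

lemma Int_convex_hull_Union_eq:
  fixes A C :: "'a::euclidean_space set"
  assumes A: "open A" "convex A"
    and B: "\<And>i. i \<in> I \<Longrightarrow> open (B i)" "\<And>i. i \<in> I \<Longrightarrow> convex (B i)"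
    and AB: "\<And>i. i \<in> I \<Longrightarrow> A \<inter> B i = C"
    and ne: "I \<noteq> {}" "C \<noteq> {}"
  shows "A \<inter> convex hull (\<Union>i\<in>I. B i) = C"
proof
  obtain k where k: "k \<in> I"
    using ne by blast
  have C: "open C" "convex C"
    using AB[OF k] A B[OF k] convex_Int by auto
  obtain w where w: "w \<in> C"
    using ne by blast
  have "B k \<subseteq> convex hull (\<Union>i\<in>I. B i)"
    using k hull_subset[of "\<Union>i\<in>I. B i" convex] by blast
  then show "C \<subseteq> A \<inter> convex hull (\<Union>i\<in>I. B i)"
    using AB[OF k] by blast
  show "A \<inter> convex hull (\<Union>i\<in>I. B i) \<subseteq> C"
  proof
    fix x assume x: "x \<in> A \<inter> convex hull (\<Union>i\<in>I. B i)"
    \<comment> \<open>The segment starts in \<open>C\<close>, so it suffices that its part in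
      \<open>C\<close> is relatively open and relatively closed, as segments are connected. Openness
      is clear; closedness is the real content.\<close>
    let ?s = "closed_segment w x"
    have closed: "b \<in> C" if b: "b \<in> closure C" "b \<in> ?s" for b
    proof (rule ccontr)
      assume "b \<notin> C"
      have "b \<in> A"
        using b(2) x w AB[OF k] closed_segment_subset[OF _ _ A(2), of w x] by blast
      \<comment> \<open>Separating \<open>C\<close> from \<open>b\<close> gives only a weak
        inequality. It becomes strict because \<open>C\<close> is open and so lies in the interior
        of the closed halfspace.\<close>
      obtain a where a: "\<And>c. c \<in> C \<Longrightarrow> a \<bullet> c < a \<bullet> b"
      proof -
        obtain a \<beta> where "a \<noteq> 0" and le: "\<forall>c\<in>C. a \<bullet> c \<le> \<beta>" and ge: "\<forall>c\<in>{b}. a \<bullet> c \<ge> \<beta>"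
          using separating_hyperplane_sets[of C "{b}"] C(2) ne(2) \<open>b \<notin> C\<close> by auto
        have "C \<subseteq> interior {c. a \<bullet> c \<le> \<beta>}"
          using C(1) le by (intro interior_maximal) auto
        then have "a \<bullet> c < a \<bullet> b" if "c \<in> C" for c
          using that ge \<open>a \<noteq> 0\<close> by force
        then show thesis
          using that by blast
      qed
      \<comment> \<open>Otherwise the open segment from \<open>y\<close> to \<open>b\<close> lies in
        \<open>B i\<close> and on the wrong side of the hyperplane through \<open>b\<close>. Near
        \<open>b\<close> it enters the open set \<open>A\<close>, hence \<open>C\<close>, against
        the choice of \<open>a\<close>.\<close>
      have "a \<bullet> y < a \<bullet> b" if i: "i \<in> I" and y: "y \<in> B i" for i y
      proof (rule ccontr)
        assume "\<not> a \<bullet> y < a \<bullet> b"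
        have "b \<noteq> y"
          using \<open>b \<notin> C\<close> \<open>b \<in> A\<close> AB[OF i] y by blast
        have seg: "open_segment y b \<subseteq> B i"
        proof -
          have "b \<in> closure (B i)"
            using b(1) AB[OF i] closure_mono[of C "B i"] by blast
          then show ?thesis
            using in_interior_closure_convex_segment[OF B(2)[OF i], of y b] y B(1)[OF i]
            by (simp add: interior_open)
        qed
        have "b \<in> closure (open_segment y b)"
          using \<open>b \<noteq> y\<close> by (simp add: closure_open_segment)
        then obtain z where z: "z \<in> A" "z \<in> open_segment y b"
          using \<open>b \<in> A\<close> A(1) open_Int_closure_eq_empty[OF A(1), of "open_segment y b"] by blast
        then have "z \<in> C"
          using seg AB[OF i] by blast
        moreover have "a \<bullet> b \<le> a \<bullet> z"
        proof -
          have "open_segment y b \<subseteq> {v. a \<bullet> v \<ge> a \<bullet> b}"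
            using \<open>\<not> a \<bullet> y < a \<bullet> b\<close> segment_open_subset_closed
              closed_segment_subset[OF _ _ convex_halfspace_ge[of "a \<bullet> b" a], of y b] by force
          then show ?thesis
            using z by blast
        qed
        ultimately show False
          using a by force
      qed
      \<comment> \<open>The open halfspace now contains the hull, thus \<open>x\<close>, and also
        \<open>w\<close>. So it contains the segment and with it \<open>b\<close>, which is
        absurd.\<close>
      then have "convex hull (\<Union>i\<in>I. B i) \<subseteq> {v. a \<bullet> v < a \<bullet> b}"
        by (intro hull_minimal convex_halfspace_lt) blast
      then have "?s \<subseteq> {v. a \<bullet> v < a \<bullet> b}"
        using x a[OF w] by (intro closed_segment_subset convex_halfspace_lt) auto
      then show False
        using b(2) by blast
    qed
    have "openin (top_of_set ?s) (?s \<inter> C)"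
      using C(1) by (rule openin_open_Int)
    moreover have "?s \<inter> C = ?s \<inter> closure C"
      using closed closure_subset by blast
    then have "closedin (top_of_set ?s) (?s \<inter> C)"
      by (simp add: closedin_closed_Int)
    ultimately have "?s \<inter> C = {} \<or> ?s \<inter> C = ?s"
      using connected_segment(1)[of w x] unfolding connected_clopen by blast
    then show "x \<in> C"
      using w by auto
  qed
qed

text \<open>Two applications of the previous lemma: the first replaces the petals over
  \<open>J\<close> by their hull. That hull is again open and convex, so in the second it serves as
  the fixed set \<open>A\<close> against the petals over \<open>I\<close>.\<close>

lemma convex_hull_Union_Int_convex_hull_Union_eq:
  fixes U :: "'i \<Rightarrow> 'a::euclidean_space set"
  assumes "\<And>i. i \<in> I \<union> J \<Longrightarrow> open (U i)" "\<And>i. i \<in> I \<union> J \<Longrightarrow> convex (U i)"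
    and "\<And>i j. i \<in> I \<Longrightarrow> j \<in> J \<Longrightarrow> U i \<inter> U j = C"
    and "I \<noteq> {}" "J \<noteq> {}" "C \<noteq> {}"
  shows "convex hull (\<Union>i\<in>I. U i) \<inter> convex hull (\<Union>j\<in>J. U j) = C"
proof -
  have "U i \<inter> convex hull (\<Union>j\<in>J. U j) = C" if "i \<in> I" for i
    using assms that by (intro Int_convex_hull_Union_eq) auto
  then have "convex hull (\<Union>j\<in>J. U j) \<inter> convex hull (\<Union>i\<in>I. U i) = C"
    using assms by (intro Int_convex_hull_Union_eq open_convex_hull) (auto simp: Int_commute)
  then show ?thesis
    by (simp add: Int_commute)
qed

theorem theorem1p1:
  fixes U :: "nat \<Rightarrow> (real ^ 'd) set" and H :: "(real ^ 'd) set"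
  assumes "sunflower (CARD('d) + 1) U"
    and "\<And>i. i \<in> {1..CARD('d) + 1} \<Longrightarrow> convex (U i)"
    and "\<And>i. i \<in> {1..CARD('d) + 1} \<Longrightarrow> open (U i)"
    and "hyperplane H"
    and "\<And>i. i \<in> {1..CARD('d) + 1} \<Longrightarrow> H \<inter> U i \<noteq> {}"
  shows "H \<inter> center (CARD('d) + 1) U \<noteq> {}"
proof -
  define N where "N = {1..CARD('d) + 1}"
  define C where "C = center (CARD('d) + 1) U"
  have pair: "U i \<inter> U j = C" if "i \<in> N" "j \<in> N" "i \<noteq> j" for i j
    using assms(1) that unfolding sunflower_def N_def C_def by blast
  \<comment> \<open>\<open>sunflower\<close> yields a nonempty center only from two distinct
    indices; they exist because the dimension is at least 1.\<close>
  have "1 \<in> N" "2 \<in> N"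
    using zero_less_card_finite[where 'a='d] by (auto simp: N_def)
  moreover have "(1::nat) \<noteq> 2"
    by simp
  ultimately have "C \<noteq> {}"
    using assms(1) unfolding sunflower_def N_def C_def by blast
  have H: "affine H" "aff_dim H = int CARD('d) - 1"
    using assms(4) by (simp_all add: hyperplane_iff_aff_dim)
  have "\<forall>i\<in>N. \<exists>y. y \<in> H \<inter> U i"
    using assms(5) unfolding N_def by blast
  then obtain p where p: "\<And>i. i \<in> N \<Longrightarrow> p i \<in> H \<inter> U i"
    using bchoice[of N "\<lambda>i y. y \<in> H \<inter> U i"] by blast
  show ?thesis
  proof (cases "inj_on p N")
    \<comment> \<open>A repeated point lies in two petals, hence already in the center.\<close>
    case False
    then obtain i j where ij: "i \<in> N" "j \<in> N" "i \<noteq> j" "p i = p j"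
      unfolding inj_on_def by blast
    then have "p i \<in> H \<inter> C"
      using p[of i] p[of j] pair[of i j] by auto
    then show ?thesis
      by (auto simp: C_def)
  next
    case True
    have "finite (p ` N)" "card (p ` N) = CARD('d) + 1"
      using True by (auto simp: card_image N_def)
    moreover have "aff_dim (p ` N) \<le> int CARD('d) - 1"
      using aff_dim_subset[of "p ` N" H] p H by auto
    \<comment> \<open>If independent, these d + 1 points would span dimension d, more than
      \<open>H\<close> has.\<close>
    ultimately have "affine_dependent (p ` N)"
      using aff_dim_affine_independent[of "p ` N"] by force
    then obtain X Y where XY: "X \<inter> Y = {}" "X \<union> Y = p ` N" "convex hull X \<inter> convex hull Y \<noteq> {}"
      using Radon_partition[OF \<open>finite (p ` N)\<close>] by blast
    then obtain q where q: "q \<in> convex hull X" "q \<in> convex hull Y"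
      by blast
    define I where "I = {i \<in> N. p i \<in> X}"
    define J where "J = {i \<in> N. p i \<in> Y}"
    have "X = p ` I" "Y = p ` J"
      using XY(2) by (auto simp: I_def J_def)
    moreover have "I \<subseteq> N" "J \<subseteq> N"
      by (auto simp: I_def J_def)
    ultimately have "X \<subseteq> (\<Union>i\<in>I. U i)" "Y \<subseteq> (\<Union>j\<in>J. U j)" and "X \<subseteq> H"
      using p by fast+
    then have "q \<in> convex hull (\<Union>i\<in>I. U i) \<inter> convex hull (\<Union>j\<in>J. U j)"
      using q hull_mono[of X _ convex] hull_mono[of Y _ convex] by (meson IntI subsetD)
    moreover have "convex hull (\<Union>i\<in>I. U i) \<inter> convex hull (\<Union>j\<in>J. U j) = C"
    proof (rule convex_hull_Union_Int_convex_hull_Union_eq)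
      show "U i \<inter> U j = C" if "i \<in> I" "j \<in> J" for i j
        using that XY(1) pair[of i j] unfolding I_def J_def by blast
      \<comment> \<open>An empty index set would have an empty hull, but \<open>q\<close> lies in
        both hulls.\<close>
      show "I \<noteq> {}" "J \<noteq> {}"
        using calculation by auto
    qed (use assms(2,3) \<open>C \<noteq> {}\<close> in \<open>auto simp: I_def J_def N_def\<close>)
    moreover have "q \<in> H"
      using q(1) hull_minimal[OF \<open>X \<subseteq> H\<close>, of convex] H(1) affine_imp_convex by blast
    ultimately show ?thesis
      by (auto simp: C_def)
  qed
qed

end
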